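(* Let $G$ be a hereditarily just-infinite group. Then either $G$ is residually finite, or the intersection $G^{(\infty)}$ of all subgroups of finite index in $G$ is simple and of finite index in $G$.
   Context: A group is just-infinite if it is infinite and all its proper quotients are finite (equivalently, it is infinite and all its non-trivial normal subgroups have finite index). A group is hereditarily just-infinite if it is infinite and all its finite index subgroups (including the group itself) are just-infinite. *)

theory Defs
  imports "HOL-Algebra.Coset"
begin

text \<open>
  A subgroup \<open>H\<close> of \<open>G\<close> is regarded as a group in its own right by restricting the carrier,
  \<open>G\<lparr>carrier := H\<rparr>\<close>.
\<close>

definition finite_index :: "'a set \<Rightarrow> ('a, 'b) monoid_scheme \<Rightarrow> bool" where
  "finite_index H G \<longleftrightarrow> subgroup H G \<and> finite (rcosets\<^bsub>G\<^esub> H)"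

definition just_infinite :: "('a, 'b) monoid_scheme \<Rightarrow> bool" where
  "just_infinite G \<longleftrightarrow>
     group G \<and> infinite (carrier G) \<and>
     (\<forall>N. N \<lhd> G \<and> N \<noteq> {\<one>\<^bsub>G\<^esub>} \<longrightarrow> finite (carrier (G Mod N)))"

definition hereditarily_just_infinite :: "('a, 'b) monoid_scheme \<Rightarrow> bool" where
  "hereditarily_just_infinite G \<longleftrightarrow>
     group G \<and> infinite (carrier G) \<and>
     (\<forall>H. finite_index H G \<longrightarrow> just_infinite (G\<lparr>carrier := H\<rparr>))"

text \<open>
  Every non-trivial element survives in some finite quotient.
\<close>

definition residually_finite :: "('a, 'b) monoid_scheme \<Rightarrow> bool" where
  "residually_finite G \<longleftrightarrow>
     group G \<and>
     (\<forall>g \<in> carrier G. g \<noteq> \<one>\<^bsub>G\<^esub> \<longrightarrow> (\<exists>N. N \<lhd> G \<and> finite (carrier (G Mod N)) \<and> g \<notin> N))"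

definition finite_residual :: "('a, 'b) monoid_scheme \<Rightarrow> 'a set" where
  "finite_residual G = \<Inter> {H. finite_index H G}"

text \<open>
  The locale \<open>simple_group\<close> of \<open>HOL-Algebra.SimpleGroups\<close> demands \<open>order G > 1\<close>, where
  \<open>order G = card (carrier G)\<close>. As the cardinality of an infinite set is \<open>0\<close>, no infinite group
  satisfies it, so simplicity is defined here without a restriction on the order.
\<close>

definition is_simple :: "('a, 'b) monoid_scheme \<Rightarrow> bool" where
  "is_simple G \<longleftrightarrow>
     group G \<and> carrier G \<noteq> {\<one>\<^bsub>G\<^esub>} \<and>
     (\<forall>N. N \<lhd> G \<longrightarrow> N = {\<one>\<^bsub>G\<^esub>} \<or> N = carrier G)"

end

theory Submission
  imports Defs
begin

text \<open>
  Let \<open>R\<close> be the finite residual of \<open>G\<close>. Every subgroup of finite index contains a normal subgroup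
  of finite index (\<open>finite_index_contains_normal\<close>), so \<open>R\<close> is also the intersection of the normal
  subgroups of finite index. Hence \<open>R\<close> is normal, and \<open>G\<close> is residually finite if \<open>R\<close> is trivial.

  If \<open>R\<close> is non-trivial, then it has finite index because \<open>G\<close> is just-infinite, and therefore \<open>R\<close> is
  just-infinite as well. A non-trivial normal subgroup \<open>N\<close> of \<open>R\<close> thus has finite index in \<open>R\<close>, hence
  in \<open>G\<close> (\<open>finite_index_trans\<close>). So \<open>N\<close> is one of the subgroups intersected to form \<open>R\<close>, which
  forces \<open>R \<subseteq> N\<close>, that is, \<open>N = R\<close>. Hence \<open>R\<close> is simple.
\<close>

context group
begin

lemma finite_index_carrier: "finite_index (carrier G) G"
proof -
  have "rcosets (carrier G) \<subseteq> {carrier G}"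
    using coset_join2 subgroup_self by (auto simp: RCOSETS_def)
  then show ?thesis
    unfolding finite_index_def using finite_subset subgroup_self by blast
qed

text \<open>
  Choose a finite set \<open>T\<close> of representatives for the cosets of \<open>H\<close> in \<open>G\<close>. Writing \<open>g = h \<otimes> t\<close> with
  \<open>h \<in> H\<close> and \<open>t \<in> T\<close> gives \<open>K #> g = (K #> h) #> t\<close>, so that \<open>K\<close> has at most as many cosets in
  \<open>G\<close> as there are pairs of a coset of \<open>K\<close> in \<open>H\<close> and an element of \<open>T\<close>.
\<close>
lemma finite_index_trans:
  assumes K: "finite_index K (G\<lparr>carrier := H\<rparr>)" and H: "finite_index H G"
  shows "finite_index K G"
proof -
  have HG: "subgroup H G" and finH: "finite (rcosets H)"
    using H by (auto simp: finite_index_def)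
  have KH: "subgroup K (G\<lparr>carrier := H\<rparr>)" and finK: "finite (rcosets\<^bsub>G\<lparr>carrier := H\<rparr>\<^esub> K)"
    using K by (auto simp: finite_index_def)
  have KG: "subgroup K G"
    using incl_subgroup[OF HG KH] .
  have "rcosets H = (\<lambda>t. H #> t) ` carrier G"
    by (auto simp: RCOSETS_def)
  then obtain T where T: "T \<subseteq> carrier G" "finite T" "rcosets H = (\<lambda>t. H #> t) ` T"
    using finite_subset_image[OF finH, of "\<lambda>t. H #> t" "carrier G"] by auto
  have "rcosets K \<subseteq> (\<lambda>(C, t). C #> t) ` ((rcosets\<^bsub>G\<lparr>carrier := H\<rparr>\<^esub> K) \<times> T)"
  proof
    fix D assume "D \<in> rcosets K"
    then obtain g where g: "g \<in> carrier G" "D = K #> g"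
      by (auto simp: RCOSETS_def)
    obtain t where t: "t \<in> T" "H #> g = H #> t"
      using T(3) rcosetsI[OF subgroup.subset[OF HG] g(1)] by auto
    then obtain h where h: "h \<in> H" "g = h \<otimes> t"
      using rcos_self[OF g(1) HG] by (auto simp: r_coset_def)
    have "D = (K #> h) #> t"
      using coset_mult_assoc[OF subgroup.subset[OF KG]] h t(1) T(1) g(2) subgroup.mem_carrier[OF HG]
      by auto
    moreover have "K #> h \<in> rcosets\<^bsub>G\<lparr>carrier := H\<rparr>\<^esub> K"
      using h(1) by (auto simp: RCOSETS_def)
    ultimately show "D \<in> (\<lambda>(C, t). C #> t) ` ((rcosets\<^bsub>G\<lparr>carrier := H\<rparr>\<^esub> K) \<times> T)"
      using t(1) by force
  qed
  then have "finite (rcosets K)"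
    using finK T(2) finite_subset by blast
  then show ?thesis
    using KG by (simp add: finite_index_def)
qed

text \<open>
  The normal core of \<open>H\<close>, obtained as the kernel of the action of \<open>G\<close> on the cosets of \<open>H\<close> by right
  multiplication. There are only finitely many self-maps of the finite set of cosets, and elements
  that act in the same way lie in the same coset of the kernel, so the kernel has finite index.
\<close>
lemma finite_index_contains_normal:
  assumes "finite_index H G"
  obtains N where "N \<lhd> G" "finite_index N G" "N \<subseteq> H"
proof -
  have HG: "subgroup H G" and finH: "finite (rcosets H)"
    using assms by (auto simp: finite_index_def)
  define N where "N = {x \<in> carrier G. \<forall>C \<in> rcosets H. C #> x = C}"
  have carr: "C \<subseteq> carrier G" if "C \<in> rcosets H" for C
    using subgroup.rcosets_carrier[OF HG is_group that] .
  have closed: "C #> x \<in> rcosets H" if C: "C \<in> rcosets H" and x: "x \<in> carrier G" for C x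
  proof -
    obtain a where a: "a \<in> carrier G" "C = H #> a"
      using C by (auto simp: RCOSETS_def)
    then have "C #> x = H #> (a \<otimes> x)"
      using coset_mult_assoc[OF subgroup.subset[OF HG]] x by simp
    then show ?thesis
      using rcosetsI[OF subgroup.subset[OF HG]] a x by simp
  qed
  have N_sub: "subgroup N G"
  proof (rule subgroupI)
    show "N \<subseteq> carrier G" by (auto simp: N_def)
    have "\<one> \<in> N" using carr by (auto simp: N_def)
    then show "N \<noteq> {}" by auto
    show "inv x \<in> N" if x: "x \<in> N" for x
    proof -
      have "C #> inv x = C" if "C \<in> rcosets H" for C
        using coset_mult_assoc[OF carr[OF that], of x "inv x"] x that carr[OF that]
        by (simp add: N_def)
      then show ?thesis using x by (simp add: N_def)
    qed
    show "x \<otimes> y \<in> N" if "x \<in> N" "y \<in> N" for x y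
      using that by (auto simp: N_def coset_mult_assoc[OF carr, symmetric])
  qed
  have "x \<otimes> n \<otimes> inv x \<in> N" if x: "x \<in> carrier G" and n: "n \<in> N" for x n
  proof -
    have nG: "n \<in> carrier G" using n by (simp add: N_def)
    have "C #> (x \<otimes> n \<otimes> inv x) = C" if C: "C \<in> rcosets H" for C
    proof -
      have "C #> (x \<otimes> n \<otimes> inv x) = ((C #> x) #> n) #> inv x"
        using x nG carr[OF C] by (simp add: coset_mult_assoc r_coset_subset_G m_assoc)
      also have "\<dots> = (C #> x) #> inv x"
        using n closed[OF C x] by (simp add: N_def)
      also have "\<dots> = C"
        using x carr[OF C] by (simp add: coset_mult_assoc)
      finally show ?thesis .
    qed
    then show ?thesis using x nG by (simp add: N_def)
  qed
  then have N_normal: "N \<lhd> G"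
    using N_sub by (simp add: normal_inv_iff)
  have N_H: "N \<subseteq> H"
  proof
    fix x assume x: "x \<in> N"
    have "H \<in> rcosets H"
      using rcosetsI[OF subgroup.subset[OF HG] one_closed] subgroup.subset[OF HG] by simp
    then have "H #> x = H" using x by (simp add: N_def)
    then show "x \<in> H" using coset_join1 x HG by (simp add: N_def)
  qed
  define act where "act x = (\<lambda>C \<in> rcosets H. C #> x)" for x
  have fin_act: "finite (act ` carrier G)"
  proof (rule finite_subset)
    show "act ` carrier G \<subseteq> (rcosets H) \<rightarrow>\<^sub>E (rcosets H)"
      using closed by (auto simp: act_def)
    show "finite ((rcosets H) \<rightarrow>\<^sub>E (rcosets H))"
      using finH by (intro finite_PiE)
  qed
  have "N #> x = N #> y" if x: "x \<in> carrier G" and y: "y \<in> carrier G" and eq: "act x = act y" for x y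
  proof -
    have "C #> (x \<otimes> inv y) = C" if C: "C \<in> rcosets H" for C
    proof -
      have "C #> x = C #> y"
        using fun_cong[OF eq, of C] C by (simp add: act_def)
      then show ?thesis
        using coset_mult_inv2 x y carr[OF C] by blast
    qed
    then have "x \<otimes> inv y \<in> N" using x y by (simp add: N_def)
    then have "N #> (x \<otimes> inv y) = N"
      using coset_join2 N_sub x y by simp
    then show ?thesis
      using coset_mult_inv1 x y subgroup.subset[OF N_sub] by blast
  qed
  then have "N #> x = N #> inv_into (carrier G) act (act x)" if "x \<in> carrier G" for x
    using that by (metis f_inv_into_f imageI inv_into_into)
  then have "rcosets N \<subseteq> (\<lambda>f. N #> inv_into (carrier G) act f) ` act ` carrier G"
    by (auto simp: RCOSETS_def)
  then have "finite (rcosets N)"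
    using fin_act finite_subset by blast
  then show ?thesis
    using that N_normal N_sub N_H by (simp add: finite_index_def)
qed

lemma finite_residual_subset: "finite_index H G \<Longrightarrow> finite_residual G \<subseteq> H"
  by (auto simp: finite_residual_def)

text \<open>
  Normality holds because \<open>finite_index_contains_normal\<close> makes the normal subgroups of finite index
  cofinal among all subgroups of finite index.
\<close>
lemma finite_residual_normal: "finite_residual G \<lhd> G"
  unfolding normal_inv_iff
proof (intro conjI ballI)
  show "subgroup (finite_residual G) G"
    unfolding finite_residual_def
    using finite_index_carrier by (intro subgroups_Inter) (auto simp: finite_index_def)
next
  fix x r assume x: "x \<in> carrier G" and r: "r \<in> finite_residual G"
  have "x \<otimes> r \<otimes> inv x \<in> H" if "finite_index H G" for H
  proof -
    obtain N where N: "N \<lhd> G" "finite_index N G" "N \<subseteq> H"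
      using finite_index_contains_normal[OF \<open>finite_index H G\<close>] .
    have "r \<in> N" using r finite_residual_subset[OF N(2)] by blast
    then show ?thesis using normal.inv_op_closed2[OF N(1) x] N(3) by blast
  qed
  then show "x \<otimes> r \<otimes> inv x \<in> finite_residual G"
    by (simp add: finite_residual_def)
qed

lemma residually_finite_if_trivial_finite_residual:
  assumes "finite_residual G = {\<one>}"
  shows "residually_finite G"
  unfolding residually_finite_def
proof (intro conjI ballI impI)
  show "group G" by (rule is_group)
next
  fix g assume "g \<in> carrier G" "g \<noteq> \<one>"
  then have "g \<notin> finite_residual G" using assms by simp
  then obtain H where "finite_index H G" "g \<notin> H"
    by (auto simp: finite_residual_def)
  then obtain N where "N \<lhd> G" "finite_index N G" "g \<notin> N"
    using finite_index_contains_normal by blast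
  then show "\<exists>N. N \<lhd> G \<and> finite (carrier (G Mod N)) \<and> g \<notin> N"
    by (auto simp: finite_index_def FactGroup_def)
qed

text \<open>
  By transitivity of finite index, the finite residual has no proper subgroup of finite index as soon
  as it has finite index itself, and a just-infinite group with this property is simple.
\<close>
lemma finite_residual_simple:
  assumes fin: "finite_index (finite_residual G) G"
    and ji: "just_infinite (G\<lparr>carrier := finite_residual G\<rparr>)"
  shows "is_simple (G\<lparr>carrier := finite_residual G\<rparr>)"
proof -
  let ?R = "G\<lparr>carrier := finite_residual G\<rparr>"
  have "N = finite_residual G" if N: "N \<lhd> ?R" and nontriv: "N \<noteq> {\<one>}" for N
  proof -
    have sub: "subgroup N ?R" using N by (rule normal_imp_subgroup)
    have "finite (rcosets\<^bsub>?R\<^esub> N)"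
      using ji N nontriv by (auto simp: just_infinite_def FactGroup_def)
    then have "finite_index N G"
      using finite_index_trans fin sub by (simp add: finite_index_def)
    then show ?thesis
      using finite_residual_subset subgroup.subset[OF sub] by auto
  qed
  moreover have "group ?R" "infinite (finite_residual G)"
    using ji by (auto simp: just_infinite_def)
  ultimately show ?thesis
    by (auto simp: is_simple_def)
qed

end

theorem proposition1p1:
  fixes G :: "('a, 'b) monoid_scheme"
  assumes "hereditarily_just_infinite G"
  shows "residually_finite G \<or>
         (is_simple (G\<lparr>carrier := finite_residual G\<rparr>) \<and> finite_index (finite_residual G) G)"
proof -
  interpret group G
    using assms by (simp add: hereditarily_just_infinite_def)
  have hji: "just_infinite (G\<lparr>carrier := H\<rparr>)" if "finite_index H G" for H
    using assms that by (simp add: hereditarily_just_infinite_def)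
  show ?thesis
  proof (cases "finite_residual G = {\<one>\<^bsub>G\<^esub>}")
    case True
    then show ?thesis by (simp add: residually_finite_if_trivial_finite_residual)
  next
    case False
    have "just_infinite G"
      using hji[OF finite_index_carrier] by simp
    then have "finite (rcosets\<^bsub>G\<^esub> (finite_residual G))"
      using finite_residual_normal False by (auto simp: just_infinite_def FactGroup_def)
    then have fin: "finite_index (finite_residual G) G"
      using normal_imp_subgroup[OF finite_residual_normal] by (simp add: finite_index_def)
    then show ?thesis
      using finite_residual_simple hji by blast
  qed
qed

end
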